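(* Well-defined equations of the original conjecture are obtained by using auxiliary variables in the identity $a=a$, namely the following ones ($\mathbb N$ is the set of positive integers). (1) For all $k\in\mathbb N\setminus\{1\}$ and all $m\in\mathbb N$ with $1\le m\le k-1$, there exist $q\in\mathbb N$ with $mq>1$ and $v\in\mathbb N$ with $(k-m)\mid v$, with $$\frac{k}{mt-v}=\frac{1}{\frac{1}{k-m}(mt-v)}+\frac1t+\frac{1}{\frac tv(mt-v)}\qquad\text{for all } t\in\{vqr: r\in\mathbb N\}.$$ (2) For all $k\in\mathbb N$ and all $v\in\mathbb N$ with $2\le v\le k$, there exists $z\in\mathbb N$ with $1\le z\le v-1$ (so $v>z$), with $$\frac{k}{kt-v}=\frac1t+\frac{1}{\frac{t(kt-v)}{z}}+\frac{1}{\frac{t(kt-v)}{v-z}}\qquad\text{for all } t\in\{lx:\ l=\operatorname{lcm}(z,v-z),\ klx>v,\ l,x\in\mathbb N\}.$$ (3) For all $m\in\mathbb N$ there exists $v\in\mathbb N$ with $v\mid m$, with $$\frac{m/v}{mt-v}=\frac{1}{tv}+\frac{1}{t(mt-v)}$$ for all $t\in\mathbb N\setminus\{1\}$ if $v=m$, and for all $t\in\mathbb N$ if $v\ne m$. (4) For all $m\in\mathbb N$ there exists $r\in\mathbb N$ with $r\mid m$, $r=ld$, $l,d\in\mathbb N$, with $$\frac{m/r}{mt-(l+d)}=\frac{1}{lt(mt-(l+d))}+\frac{1}{rt}+\frac{1}{dt(mt-(l+d))}$$ for all $t\in\mathbb N\setminus\{1\}$ if $r=m$ and $l+d=m$, and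 for all $t\in\mathbb N$ if $r\neq m$. (5) For all $k\in\mathbb N$ there exists $w\in\mathbb N$ with $(2k-1)w\ne1$, with $$\frac{k}{(kw-1)t+((k-1)w-1)}=\frac{1}{w(t+1)}+\frac{1}{w((kw-1)t+((k-1)w-1))}+\frac{1}{(t+1)((kw-1)t+((k-1)w-1))}$$ for all $t\in\mathbb N\setminus\{1\}$ if $(2k-1)w=2$; for all $t\in\mathbb N$ if $(2k-1)w>2$ and $k\in\{1,2\}$; for all $t\in\mathbb N\cup\{0\}$ if $(2k-1)w>2$ and $k>2$. In another form: for all $w\in\mathbb N$, with $S\equiv-1\pmod w$, $G\equiv-1\pmod w$, $\frac{S+1}{k}=\frac{G+1}{k-1}=w$, $k\in\mathbb N$, and $M\equiv G\pmod S$, $$\frac kM=\frac{k}{St+G}=\frac{1}{w(t+1)}+\frac{1}{w(St+G)}+\frac{1}{(t+1)(St+G)}.$$ (6) For all $k\in\mathbb N$ there exists $w\in\mathbb N$ with $kw>1$, with $$\frac{k}{(kw-1)(t-w)}=\frac{1}{w(t-w)}+\frac{1}{wt(kw-1)}+\frac{1}{t(kw-1)(t-w)}\qquad\text{for all } t\in\mathbb N,\ t>w.$$ (7) For all $k\in\mathbb N$ there exists $w\in\mathbb N$ with $kw>1$, with $$\frac{k}{(kw-1)(v-1)}=\frac{1}{w(v-1)}+\frac{1}{vw(kw-1)}+\frac{1}{vw(kw-1)(v-1)}\qquad\text{for all } v\in\mathbb N\setminus\{1\}.$$ (8) For all $A\in\mathbb N\setminus\{1\}$ with prime factorization $A=p_1^{a_1}p_2^{a_2}\cdots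 p_i^{a_i}$, put $A_1=p_1p_2\cdots p_i$. For all $b\in\mathbb N$ there exists $c\in\mathbb N$, with $b>c$ and $b\ne1$ if $A=A_1$, and $b\ge c$ if $A\neq A_1$, and there exists $n\in\mathbb N$ with $A^b-A_1^c>n$, with $$\frac{A^b}{p_1^{a_1}\cdots p_i^{a_i}(A^b-A_1^c-n)n}=\frac{1}{(p_1^{a_1}\cdots p_i^{a_i})n}+\frac{1}{p_1^{a_1+c}p_2^{a_2+c}\cdots p_i^{a_i+c}(A^b-A_1^c-n)n}+\frac{1}{p_1^{a_1}\cdots p_i^{a_i}(A^b-A_1^c-n)}.$$ (9) For all $k\in\mathbb N$ there exist $r,v,w,s,l,q\in\mathbb N$ with $(krv-l)s\ge rw$ and $\bigl((krv-l)s-rw\bigr)\mid rvwls$, with the equivalence of equations $$\left(\frac{k}{wl}=\frac{1}{rvw}+\frac{1}{vls}+\frac{1}{\frac{rvwls}{(krv-l)s-rw}}\right)\equiv\left(\frac1s=\frac{krv-l}{rw}-\frac{vl}{q}\right).$$ (10) For all $k\in\mathbb N$ and all $m\in\mathbb N$ there exist $v,b\in\mathbb N$ with $kmv>\mp b$ and $s\in\mathbb N$ with $(\mp sb\pm v)\mid mvs(kmv\pm b)$, with $$\frac{k}{kmv\pm b}=\frac{1}{mv}\mp\frac{1}{ms(kmv\pm b)}+\frac{1}{\frac{mvs(kmv\pm b)}{\mp sb\pm v}}.$$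
   Context: The "original conjecture" concerns the equation $\frac kn=\frac1\alpha+\frac1\beta+\frac1\gamma$ with $\frac kn\le 3$ and $\alpha,\beta,\gamma$ positive integers. A "well-defined equation" is an explicit parametrized equation expressing a fraction $\frac{k}{M}$ as a sum (possibly with signs) of unit fractions, $\frac{k}{M}=\frac1{\beta_1}+\frac1{\beta_2}+\cdots\pm\frac1{\beta_s}$, where $M$ and the $\beta_i$ are given by formulas in the parameters. In (10) the signs are taken consistently, all upper or all lower. In (9), "$\equiv$" between the two equations means that they are equivalent.
   Formalization: In (8) the exponents a_j+c in the middle denominator are corrected to a_j−c, since the printed equation would force A_1^{2c}=1 and never holds; b=1 is excluded when A=A_1. In (5), (G+1)/(k−1)=w is read as G+1=(k−1)w. *)

theory Defs
  imports Complex_Main "HOL-Number_Theory.Number_Theory"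
begin

text \<open>Positive integers. The parameters are taken in \<^typ>\<open>int\<close>, so that differences such as
  \<open>m * t - v\<close> are not truncated.\<close>

abbreviation pos_int :: "int set"
  where "pos_int \<equiv> {0<..}"

abbreviation pos_nat :: "nat set"
  where "pos_nat \<equiv> {0<..}"

text \<open>The equation \<open>k / M = 1 / \<beta>\<^sub>1 + \<dots> + 1 / \<beta>\<^sub>s\<close> with \<open>k\<close>, \<open>M\<close> and
  all \<open>\<beta>\<^sub>i\<close> positive integers. They are given as reals because the formulas for the
  \<open>\<beta>\<^sub>i\<close> contain quotients; the integrality is part of the assertion, and positivity rules
  out the convention \<open>x / 0 = 0\<close>.\<close>

definition unit_fraction_eq :: "real \<Rightarrow> real \<Rightarrow> real list \<Rightarrow> bool"
  where "unit_fraction_eq k M \<beta>s \<longleftrightarrow>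
    (\<forall>x \<in> set (k # M # \<beta>s). x \<in> \<int> \<and> x > 0) \<and> k / M = (\<Sum>\<beta>\<leftarrow>\<beta>s. 1 / \<beta>)"

text \<open>For \<open>A = \<Prod>\<^sub>j p\<^sub>j ^ a\<^sub>j\<close> and an integer \<open>e\<close>, the number
  \<open>\<Prod>\<^sub>j p\<^sub>j ^ (a\<^sub>j + e)\<close>. For \<open>e < 0\<close> it need not be an integer.
  It is needed with \<open>e = - c\<close>: writing \<open>A\<^sub>1 = \<Prod>\<^sub>j p\<^sub>j\<close> and
  \<open>D = A ^ b - A\<^sub>1 ^ c - n\<close>, division of \<open>A ^ b = D + A\<^sub>1 ^ c + n\<close> by
  \<open>A * D * n\<close> turns the summand \<open>A\<^sub>1 ^ c\<close> into the unit fraction with denominator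
  \<open>(\<Prod>\<^sub>j p\<^sub>j ^ (a\<^sub>j - c)) * D * n\<close>. With \<open>a\<^sub>j + c\<close> in place of
  \<open>a\<^sub>j - c\<close>, the equation fails for all \<open>c > 0\<close>.\<close>

definition shifted_factorization :: "nat \<Rightarrow> int \<Rightarrow> real"
  where "shifted_factorization A e =
    (\<Prod>p\<in>prime_factors A. real p powi (int (multiplicity p A) + e))"

end

theory Submission
  imports Defs
begin

text \<open>Each of the ten equations arises from a trivial identity by division. Multiply the numerator
  of \<open>k / M\<close> by an auxiliary number \<open>u\<close> and split the product as
  \<open>k * u = x\<^sub>1 + \<dots> + x\<^sub>s\<close>. Division by \<open>M * u\<close> gives
  \<open>k / M = x\<^sub>1 / (M * u) + \<dots> + x\<^sub>s / (M * u)\<close>, and the summands are unit fractions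
  as soon as every \<open>x\<^sub>i\<close> divides \<open>M * u\<close>. Lemma \<open>fraction_eq_sum_list\<close> is this
  observation, and \<open>unit_fraction_eqI\<close> adds integrality and positivity. What remains for each
  family is to name \<open>u\<close> and the splitting:

  \<^item> (1) \<open>u = t\<close> and \<open>k * t = (k - m) * t + (m * t - v) + v\<close>;
  \<^item> (2) \<open>u = t\<close> and \<open>k * t = (k * t - v) + z + (v - z)\<close>;
  \<^item> (3) \<open>u = t * v\<close> and \<open>m * t = (m * t - v) + v\<close>;
  \<^item> (4) \<open>u = r * t\<close> and \<open>m * t = d + (m * t - (l + d)) + l\<close>;
  \<^item> (5) \<open>u = w * (t + 1)\<close> and \<open>k * w * (t + 1) = M + (t + 1) + w\<close>;
  \<^item> (6) \<open>u = w * t\<close> and \<open>k * w * t = t * (k * w - 1) + (t - w) + w\<close>;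
  \<^item> (7) \<open>u = v * w\<close> and \<open>k * v * w = v * (k * w - 1) + (v - 1) + 1\<close>;
  \<^item> (8) \<open>u = 1\<close> and \<open>A ^ b = (A ^ b - A\<^sub>1 ^ c - n) + A\<^sub>1 ^ c + n\<close>;
  \<^item> (9) \<open>u = r * v * s\<close> and
    \<open>k * r * v * s = l * s + r * w + ((k * r * v - l) * s - r * w)\<close>;
  \<^item> (10) \<open>u = m * v * s\<close> and, with \<open>M = k * m * v + \<sigma> * b\<close>,
    \<open>k * m * v * s = s * M - \<sigma> * v + (\<sigma> * v - \<sigma> * s * b)\<close>.

  The second equation of (9) is the first one solved for its last denominator, called \<open>q\<close>.

  These equations hold for all parameters for which the denominators are nonzero, so the
  existential quantifiers ask only for parameters that meet the sign and divisibility conditions,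
  and small values do: for instance \<open>v = k - m\<close> in (1), \<open>z = 1\<close> in (2), \<open>w = 2\<close> in (5) to (7),
  \<open>c = n = 1\<close> in (8), and a divisor equal to \<open>1\<close> in (9) and (10).\<close>

section \<open>Splitting a multiple of the numerator\<close>

lemma fraction_eq_sum_list:
  fixes k M u :: real
  assumes "M \<noteq> 0" "u \<noteq> 0" "k * u = sum_list xs" "list_all2 (\<lambda>\<beta> x. \<beta> * x = M * u) \<beta>s xs"
  shows "k / M = (\<Sum>\<beta>\<leftarrow>\<beta>s. 1 / \<beta>)"
proof -
  have "(\<Sum>\<beta>\<leftarrow>\<beta>s. 1 / \<beta>) = sum_list xs / (M * u)"
    using assms(4)
  proof (induction rule: list_all2_induct)
    case (Cons \<beta> \<beta>s x xs)
    have "\<beta> * x = M * u" and "M * u \<noteq> 0"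
      using Cons assms by simp_all
    then have "1 / \<beta> = x / (M * u)"
      by (metis divide_self_if mult_zero_left nonzero_divide_mult_cancel_right mult_zero_right)
    then show ?case
      using Cons by (simp add: add_divide_distrib)
  qed simp
  also have "\<dots> = k / M"
    using assms by (simp flip: assms(3))
  finally show ?thesis ..
qed

lemma unit_fraction_eqI:
  fixes k M u :: int
  assumes "k > 0" "M > 0" "u > 0" "k * u = sum_list xs"
    and "list_all2 (\<lambda>\<beta> x. \<beta> > 0 \<and> \<beta> * x = M * u) \<beta>s xs"
  shows "unit_fraction_eq (of_int k) (of_int M) (map of_int \<beta>s)"
proof -
  have "list_all2 (\<lambda>\<beta> x. \<beta> * x = real_of_int M * of_int u) (map of_int \<beta>s) (map of_int xs)"
    using assms(5) unfolding list.rel_map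
    by (rule list_all2_mono) (metis of_int_mult)
  moreover have "real_of_int k * of_int u = sum_list (map of_int xs)"
  proof -
    have "real_of_int (sum_list xs) = sum_list (map of_int xs)"
      by (induction xs) auto
    then show ?thesis
      by (simp flip: assms(4))
  qed
  ultimately have "real_of_int k / of_int M = (\<Sum>\<beta>\<leftarrow>map of_int \<beta>s. 1 / \<beta>)"
    using assms by (intro fraction_eq_sum_list) auto
  moreover have "\<forall>\<beta>\<in>set \<beta>s. \<beta> > 0"
    using assms(5) by (auto simp: list_all2_conv_all_nth in_set_conv_nth)
  ultimately show ?thesis
    using assms unfolding unit_fraction_eq_def by auto
qed

section \<open>Families with denominator linear in the parameter\<close>

lemma unit_fractions_linear:
  fixes k m q r t v :: int
  assumes "0 < m" "m < k" "0 < v" "k - m dvd v" "m * q > 1" "r > 0" and t: "t = v * q * r"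
  shows "unit_fraction_eq (of_int k) (of_int (m * t - v))
    [1 / of_int (k - m) * of_int (m * t - v), of_int t, of_int t / of_int v * of_int (m * t - v)]"
proof -
  define M where "M = m * t - v"
  define h where "h = v div (k - m)"
  have v: "v = (k - m) * h"
    using assms by (simp add: h_def)
  have "h > 0"
    using v assms by (simp add: zero_less_mult_iff)
  have "q > 0"
    using assms by (smt (verit) mult_nonneg_nonpos)
  have M: "M = v * (m * q * r - 1)"
    by (simp add: M_def t algebra_simps)
  have "m * q * r > 1"
    using assms by (smt (verit) mult_le_cancel_left1)
  then have "m * q * r - 1 > 0"
    by simp
  have "M > 0" "t > 0"
    using M t \<open>m * q * r > 1\<close> \<open>q > 0\<close> assms by simp_all
  have "unit_fraction_eq (of_int k) (of_int M) (map of_int [h * (m * q * r - 1), t, q * r * M])"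
  proof (rule unit_fraction_eqI)
    show "k * t = sum_list [(k - m) * t, M, v]"
      by (simp add: M_def algebra_simps)
    show "list_all2 (\<lambda>\<beta> x. \<beta> > 0 \<and> \<beta> * x = M * t)
        [h * (m * q * r - 1), t, q * r * M] [(k - m) * t, M, v]"
      using \<open>h > 0\<close> \<open>m * q * r - 1 > 0\<close> \<open>t > 0\<close> \<open>q > 0\<close> \<open>r > 0\<close> \<open>M > 0\<close> M v t
      by (auto intro: mult_pos_pos)
  qed (use assms \<open>M > 0\<close> \<open>t > 0\<close> in auto)
  moreover have "1 / of_int (k - m) * of_int M = real_of_int (h * (m * q * r - 1))"
  proof -
    have "real_of_int M = of_int (k - m) * of_int (h * (m * q * r - 1))"
      unfolding M v of_int_mult by simp
    then show ?thesis
      using assms by simp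
  qed
  moreover have "of_int t / of_int v * of_int M = real_of_int (q * r * M)"
    using assms by (simp add: t)
  ultimately show ?thesis
    unfolding M_def by simp
qed

lemma unit_fractions_two_over_product:
  fixes k t v z :: int
  assumes "0 < k" "0 < z" "z < v" "0 < t" "z dvd t" "v - z dvd t" "k * t > v"
  shows "unit_fraction_eq (of_int k) (of_int (k * t - v))
    [of_int t, of_int (t * (k * t - v)) / of_int z, of_int (t * (k * t - v)) / of_int (v - z)]"
proof -
  define M where "M = k * t - v"
  have "M > 0"
    using assms by (simp add: M_def)
  have div: "t = z * (t div z)" "t = (v - z) * (t div (v - z))"
    using assms by simp_all
  have pos: "t div z > 0" "t div (v - z) > 0"
    using assms by (simp_all add: pos_imp_zdiv_pos_iff zdvd_imp_le)
  have "unit_fraction_eq (of_int k) (of_int M)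
      (map of_int [t, t div z * M, t div (v - z) * M])"
  proof (rule unit_fraction_eqI)
    show "k * t = sum_list [M, z, v - z]"
      by (simp add: M_def)
    show "list_all2 (\<lambda>\<beta> x. \<beta> > 0 \<and> \<beta> * x = M * t)
        [t, t div z * M, t div (v - z) * M] [M, z, v - z]"
      using pos \<open>M > 0\<close> \<open>t > 0\<close> assms by (simp add: mult.commute mult.left_commute)
  qed (use assms \<open>M > 0\<close> in auto)
  moreover have "real_of_int (t div z * M) = of_int (t * M) / of_int z"
    using assms by (simp add: real_of_int_div)
  moreover have "real_of_int (t div (v - z) * M) = of_int (t * M) / of_int (v - z)"
    using assms(6) by (simp only: of_int_mult real_of_int_div times_divide_eq_left)
  ultimately show ?thesis
    unfolding M_def by (simp only: list.map)
qed

lemma unit_fractions_two_terms: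
  fixes m t v :: int
  assumes "0 < m" "0 < v" "v dvd m" "0 < t" "m * t > v"
  shows "unit_fraction_eq (of_int m / of_int v) (of_int (m * t - v))
    [of_int (t * v), of_int (t * (m * t - v))]"
proof -
  have m: "m = v * (m div v)"
    using assms by simp
  have "unit_fraction_eq (of_int (m div v)) (of_int (m * t - v))
      (map of_int [t * v, t * (m * t - v)])"
  proof (rule unit_fraction_eqI)
    show "m div v * (t * v) = sum_list [m * t - v, v]"
      using assms by (auto elim!: dvdE)
    show "m div v > 0"
      using assms by (simp add: pos_imp_zdiv_pos_iff zdvd_imp_le)
  qed (use assms in auto)
  then show ?thesis
    using assms by (simp add: real_of_int_div)
qed

lemma unit_fractions_divisor_pair:
  fixes m t l d :: int
  assumes "0 < m" "0 < l" "0 < d" "l * d dvd m" "0 < t" "m * t > l + d"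
  shows "unit_fraction_eq (of_int m / of_int (l * d)) (of_int (m * t - (l + d)))
    [of_int (l * t * (m * t - (l + d))), of_int (l * d * t), of_int (d * t * (m * t - (l + d)))]"
proof -
  define M where "M = m * t - (l + d)"
  have "M > 0"
    using assms by (simp add: M_def)
  have ld: "l * d > 0"
    using assms by simp
  have "unit_fraction_eq (of_int (m div (l * d))) (of_int M)
      (map of_int [l * t * M, l * d * t, d * t * M])"
  proof (rule unit_fraction_eqI)
    show "m div (l * d) * (l * d * t) = sum_list [d, M, l]"
    proof -
      have "m div (l * d) * (l * d * t) = (m div (l * d) * (l * d)) * t"
        by (simp only: mult.assoc)
      also have "\<dots> = m * t"
        using assms(4) by (simp only: dvd_div_mult_self)
      finally show ?thesis
        by (simp add: M_def)
    qed
    show "m div (l * d) > 0"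
      using assms ld by (simp add: pos_imp_zdiv_pos_iff zdvd_imp_le)
  qed (use assms \<open>M > 0\<close> in auto)
  then show ?thesis
    unfolding M_def real_of_int_div[OF assms(4)] by (simp only: list.map)
qed

section \<open>Families built on \<open>k * w - 1\<close>\<close>

text \<open>The residue \<open>(k - 1) * w - 1\<close> modulo \<open>k * w - 1\<close> is chosen so that \<open>M\<close> falls short of
  \<open>k * w * (t + 1)\<close> by exactly \<open>(t + 1) + w\<close>, the sum of two divisors of \<open>w * (t + 1)\<close>.\<close>

lemma unit_fractions_residue_class:
  fixes k w t M :: int
  assumes "0 < k" "0 < w" "0 \<le> t" "0 < M" and M: "M = (k * w - 1) * t + ((k - 1) * w - 1)"
  shows "unit_fraction_eq (of_int k) (of_int M)
    [of_int (w * (t + 1)), of_int (w * M), of_int ((t + 1) * M)]"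
proof -
  have "unit_fraction_eq (of_int k) (of_int M) (map of_int [w * (t + 1), w * M, (t + 1) * M])"
  proof (rule unit_fraction_eqI)
    show "k * (w * (t + 1)) = sum_list [M, t + 1, w]"
      by (simp add: M algebra_simps)
  qed (use assms(1-4) in auto)
  then show ?thesis
    by (simp only: list.map)
qed

lemma unit_fractions_shift:
  fixes k w t :: int
  assumes "0 < k" "0 < w" "k * w > 1" "t > w"
  shows "unit_fraction_eq (of_int k) (of_int ((k * w - 1) * (t - w)))
    [of_int (w * (t - w)), of_int (w * t * (k * w - 1)), of_int (t * (k * w - 1) * (t - w))]"
proof -
  have "unit_fraction_eq (of_int k) (of_int ((k * w - 1) * (t - w)))
      (map of_int [w * (t - w), w * t * (k * w - 1), t * (k * w - 1) * (t - w)])"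
  proof (rule unit_fraction_eqI)
    show "k * (w * t) = sum_list [t * (k * w - 1), t - w, w]"
      by (simp add: algebra_simps)
  qed (use assms in auto)
  then show ?thesis
    by (simp only: list.map)
qed

lemma unit_fractions_shift_one:
  fixes k w v :: int
  assumes "0 < k" "0 < w" "k * w > 1" "v > 1"
  shows "unit_fraction_eq (of_int k) (of_int ((k * w - 1) * (v - 1)))
    [of_int (w * (v - 1)), of_int (v * w * (k * w - 1)), of_int (v * w * (k * w - 1) * (v - 1))]"
proof -
  have "unit_fraction_eq (of_int k) (of_int ((k * w - 1) * (v - 1)))
      (map of_int [w * (v - 1), v * w * (k * w - 1), v * w * (k * w - 1) * (v - 1)])"
  proof (rule unit_fraction_eqI)
    show "k * (v * w) = sum_list [v * (k * w - 1), v - 1, 1]"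
      by (simp add: algebra_simps)
  qed (use assms in auto)
  then show ?thesis
    by (simp only: list.map)
qed

section \<open>Powers and radicals\<close>

lemma shifted_factorization_0:
  "A > 0 \<Longrightarrow> shifted_factorization A 0 = real A"
  using prime_factorization_nat[of A]
  by (simp add: shifted_factorization_def flip: of_nat_power of_nat_prod)

lemma shifted_factorization_neg:
  assumes "A > 0"
  shows "shifted_factorization A (- int c) = real A / real ((\<Prod>p\<in>prime_factors A. p) ^ c)"
proof -
  have "shifted_factorization A (- int c) =
      (\<Prod>p\<in>prime_factors A. real p ^ multiplicity p A / real p ^ c)"
    unfolding shifted_factorization_def
  proof (rule prod.cong)
    fix p assume "p \<in> prime_factors A"
    then have "real p \<noteq> 0"
      by (metis in_prime_factors_imp_prime not_prime_0 of_nat_eq_0_iff)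
    then show "real p powi (int (multiplicity p A) + - int c) = real p ^ multiplicity p A / real p ^ c"
      by (simp add: power_int_diff)
  qed simp
  also have "\<dots> = shifted_factorization A 0 / real ((\<Prod>p\<in>prime_factors A. p) ^ c)"
    by (simp add: shifted_factorization_def prod_dividef prod_power_distrib)
  finally show ?thesis
    using assms by (simp add: shifted_factorization_0)
qed

lemma unit_fractions_radical:
  fixes A b c R :: nat and n :: int
  assumes "A > 0" and R: "R = (\<Prod>p\<in>prime_factors A. p)" and "R ^ c dvd A"
    and "n > 0" "int A ^ b - int R ^ c > n"
  shows "unit_fraction_eq (of_nat (A ^ b))
    (shifted_factorization A 0 * of_int (int A ^ b - int R ^ c - n) * of_int n)
    [shifted_factorization A 0 * of_int n,
     shifted_factorization A (- int c) * of_int (int A ^ b - int R ^ c - n) * of_int n,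
     shifted_factorization A 0 * of_int (int A ^ b - int R ^ c - n)]"
proof -
  define D where "D = int A ^ b - int R ^ c - n"
  define E where "E = A div R ^ c"
  have A: "A = E * R ^ c"
    using assms(3) by (simp add: E_def)
  then have "E > 0" "R ^ c > 0"
    using \<open>A > 0\<close> by (auto simp del: zero_less_power)
  have "D > 0"
    using assms by (simp add: D_def)
  have "unit_fraction_eq (of_int (int A ^ b)) (of_int (int A * D * n))
      (map of_int [int A * n, int E * D * n, int A * D])"
  proof (rule unit_fraction_eqI)
    show "int A ^ b * 1 = sum_list [D, int R ^ c, n]"
      by (simp add: D_def)
    show "list_all2 (\<lambda>\<beta> x. \<beta> > 0 \<and> \<beta> * x = int A * D * n * 1)
        [int A * n, int E * D * n, int A * D] [D, int R ^ c, n]"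
      using \<open>A > 0\<close> \<open>E > 0\<close> \<open>D > 0\<close> \<open>n > 0\<close> arg_cong[OF A, of int] by simp
  qed (use assms \<open>D > 0\<close> in auto)
  moreover have "shifted_factorization A (- int c) = real E"
    unfolding shifted_factorization_neg[OF \<open>A > 0\<close>] R[symmetric] E_def
    using assms(3) by (simp add: real_of_nat_div)
  ultimately show ?thesis
    using \<open>A > 0\<close> by (simp add: shifted_factorization_0 flip: D_def)
qed

text \<open>With \<open>c = n = 1\<close> the condition \<open>A ^ b - A\<^sub>1 ^ c > n\<close> needs a gap of at least two between the
  power and the radical. The radical divides \<open>A\<close>, so the gap between distinct multiples of it is at
  least the radical itself, which is at least \<open>2\<close>; for squarefree \<open>A\<close> the
  exponent \<open>b > 1\<close> provides the larger multiple.\<close>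

lemma power_minus_radical_gt_1:
  fixes A b R :: nat
  assumes "A > 1" and R: "R = (\<Prod>p\<in>prime_factors A. p)" and "b > 0" and "A = R \<longrightarrow> b \<noteq> 1"
  shows "R dvd A" and "int A ^ b - int R > 1"
proof -
  have "(\<Prod>p\<in>prime_factors A. p) dvd (\<Prod>p\<in>prime_factors A. p ^ multiplicity p A)"
    by (intro prod_dvd_prod) (auto simp: prime_factors_multiplicity)
  then show "R dvd A"
    using prime_factorization_nat[of A] \<open>A > 1\<close> R by simp
  then obtain h where h: "A = R * h" ..
  obtain p where p: "prime p" "p dvd A"
    using \<open>A > 1\<close> prime_factor_nat[of A] by auto
  then have "p dvd R"
    unfolding R using \<open>A > 1\<close> by (intro dvd_prodI) (auto simp: prime_factors_dvd)
  moreover have "R > 0"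
    using h \<open>A > 1\<close> by (cases R) auto
  ultimately have "R \<ge> 2"
    using p prime_ge_2_nat[of p] dvd_imp_le[of p R] by linarith
  have "2 * R \<le> A ^ b"
  proof (cases "A = R")
    case True
    then have "b \<ge> 2"
      using assms by linarith
    then have "R ^ 2 \<le> A ^ b"
      using True \<open>R \<ge> 2\<close> by (simp add: power_increasing)
    moreover have "2 * R \<le> R ^ 2"
      using \<open>R \<ge> 2\<close> by (simp add: power2_eq_square)
    ultimately show ?thesis
      by linarith
  next
    case False
    then have "h \<noteq> 1"
      using h by auto
    moreover have "h \<noteq> 0"
      using h \<open>A > 1\<close> by (cases h) auto
    ultimately have "2 \<le> h"
      by linarith
    then have "2 * R \<le> A"
      unfolding h by (simp add: mult.commute)
    also have "A \<le> A ^ b"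
      using \<open>A > 1\<close> \<open>b > 0\<close> by (intro self_le_power) auto
    finally show ?thesis .
  qed
  then have "2 * int R \<le> int A ^ b"
    by (metis of_nat_le_iff of_nat_mult of_nat_numeral of_nat_power)
  then show "int A ^ b - int R > 1"
    using \<open>R \<ge> 2\<close> by linarith
qed

section \<open>An equation with a quotient denominator and one with signs\<close>

lemma three_fractions_eq:
  fixes k r v w s l :: int
  assumes "r > 0" "v > 0" "w > 0" "s > 0" "l > 0" and "(k * r * v - l) * s \<noteq> r * w"
  shows "real_of_int k / of_int (w * l) =
    1 / of_int (r * v * w) + 1 / of_int (v * l * s) +
    1 / (of_int (r * v * w * l * s) / of_int ((k * r * v - l) * s - r * w))"
proof -
  define D where "D = (k * r * v - l) * s - r * w"
  have "D \<noteq> 0"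
    using assms by (simp add: D_def)
  have "real_of_int k / of_int (w * l) =
    (\<Sum>\<beta>\<leftarrow>[of_int (r * v * w), of_int (v * l * s), of_int (r * v * w * l * s) / of_int D]. 1 / \<beta>)"
  proof (rule fraction_eq_sum_list)
    show "real_of_int k * of_int (r * v * s) = sum_list [of_int (l * s), of_int (r * w), of_int D]"
      by (simp add: D_def algebra_simps)
  qed (use assms \<open>D \<noteq> 0\<close> in auto)
  then show ?thesis
    by (simp add: D_def)
qed

text \<open>The difference of \<open>(k * r * v - l) / (r * w)\<close> and \<open>1 / s\<close> is
  \<open>((k * r * v - l) * s - r * w) / (r * w * s)\<close>, so the second equation of (9) determines \<open>q\<close>: it
  is the last denominator of the first equation.\<close>

lemma inverse_eq_diff_iff:
  fixes k r v w s l q :: int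
  assumes "r > 0" "v > 0" "w > 0" "s > 0" "l > 0" "q > 0"
  shows "1 / real_of_int s = of_int (k * r * v - l) / of_int (r * w) - of_int (v * l) / of_int q \<longleftrightarrow>
    q * ((k * r * v - l) * s - r * w) = r * v * w * l * s"
proof -
  define a where "a = k * r * v - l"
  have "1 / real_of_int s = of_int a / of_int (r * w) - of_int (v * l) / of_int q \<longleftrightarrow>
      real_of_int (q * (a * s - r * w)) = of_int (r * v * w * l * s)"
    using assms by (simp add: field_simps) (rule eq_commute)
  then show ?thesis
    unfolding a_def of_int_eq_iff .
qed

lemma signed_fractions_eq:
  fixes \<sigma> k m v b s :: int
  assumes "\<sigma> \<in> {1, - 1}" "m > 0" "v > 0" "s > 0"
    and "k * m * v + \<sigma> * b \<noteq> 0" "- \<sigma> * s * b + \<sigma> * v \<noteq> 0"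
  shows "real_of_int k / of_int (k * m * v + \<sigma> * b) =
    1 / of_int (m * v) - of_int \<sigma> * (1 / of_int (m * s * (k * m * v + \<sigma> * b))) +
    1 / (of_int (m * v * s * (k * m * v + \<sigma> * b)) / of_int (- \<sigma> * s * b + \<sigma> * v))"
proof -
  define M where "M = k * m * v + \<sigma> * b"
  define z where "z = - \<sigma> * s * b + \<sigma> * v"
  have "M \<noteq> 0" "z \<noteq> 0"
    using assms by (simp_all add: M_def z_def)
  have "real_of_int k / of_int M =
    (\<Sum>\<beta>\<leftarrow>[of_int (m * v), of_int (- \<sigma> * (m * s * M)), of_int (m * v * s * M) / of_int z]. 1 / \<beta>)"
  proof (rule fraction_eq_sum_list)
    show "real_of_int k * of_int (m * v * s) = sum_list [of_int (s * M), of_int (- \<sigma> * v), of_int z]"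
      by (simp add: M_def z_def algebra_simps)
  qed (use assms \<open>M \<noteq> 0\<close> \<open>z \<noteq> 0\<close> in auto)
  also have "\<dots> = 1 / of_int (m * v) - of_int \<sigma> * (1 / of_int (m * s * M)) +
    1 / (of_int (m * v * s * M) / of_int z)"
    using assms(1) by auto
  finally show ?thesis
    unfolding M_def z_def .
qed

section \<open>The ten families\<close>

theorem theorem4p2:
  shows "
   \<comment> \<open>(1)\<close>
   (\<forall>k\<in>pos_int - {1}. \<forall>m\<in>pos_int. 1 \<le> m \<and> m \<le> k - 1 \<longrightarrow>
      (\<exists>q\<in>pos_int. m * q > 1 \<and> (\<exists>v\<in>pos_int. (k - m) dvd v \<and>
        (\<forall>t\<in>{v * q * r |r. r \<in> pos_int}.
          unit_fraction_eq (of_int k) (of_int (m * t - v))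
            [1 / of_int (k - m) * of_int (m * t - v),
             of_int t,
             of_int t / of_int v * of_int (m * t - v)])))) \<and>
   \<comment> \<open>(2)\<close>
   (\<forall>k\<in>pos_int. \<forall>v\<in>pos_int. 2 \<le> v \<and> v \<le> k \<longrightarrow>
      (\<exists>z\<in>pos_int. 1 \<le> z \<and> z \<le> v - 1 \<and>
        (\<forall>t\<in>{l * x |l x. l = lcm z (v - z) \<and> k * l * x > v \<and> l \<in> pos_int \<and> x \<in> pos_int}.
          unit_fraction_eq (of_int k) (of_int (k * t - v))
            [of_int t,
             of_int (t * (k * t - v)) / of_int z,
             of_int (t * (k * t - v)) / of_int (v - z)]))) \<and>
   \<comment> \<open>(3)\<close>
   (\<forall>m\<in>pos_int. \<exists>v\<in>pos_int. v dvd m \<and>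
      (\<forall>t\<in>(if v = m then pos_int - {1} else pos_int).
        unit_fraction_eq (of_int m / of_int v) (of_int (m * t - v))
          [of_int (t * v), of_int (t * (m * t - v))])) \<and>
   \<comment> \<open>(4)\<close>
   (\<forall>m\<in>pos_int. \<exists>r\<in>pos_int. \<exists>l\<in>pos_int. \<exists>d\<in>pos_int. r dvd m \<and> r = l * d \<and>
      (r = m \<and> l + d = m \<longrightarrow> (\<forall>t\<in>pos_int - {1}.
        unit_fraction_eq (of_int m / of_int r) (of_int (m * t - (l + d)))
          [of_int (l * t * (m * t - (l + d))),
           of_int (r * t),
           of_int (d * t * (m * t - (l + d)))])) \<and>
      (r \<noteq> m \<longrightarrow> (\<forall>t\<in>pos_int.
        unit_fraction_eq (of_int m / of_int r) (of_int (m * t - (l + d)))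
          [of_int (l * t * (m * t - (l + d))),
           of_int (r * t),
           of_int (d * t * (m * t - (l + d)))]))) \<and>
   \<comment> \<open>(5), first form\<close>
   (\<forall>k\<in>pos_int. \<exists>w\<in>pos_int. (2 * k - 1) * w \<noteq> 1 \<and>
      (\<forall>t. ((2 * k - 1) * w = 2 \<and> t \<in> pos_int - {1} \<or>
            (2 * k - 1) * w > 2 \<and> k \<in> {1, 2} \<and> t \<in> pos_int \<or>
            (2 * k - 1) * w > 2 \<and> k > 2 \<and> t \<in> pos_int \<union> {0}) \<longrightarrow>
        unit_fraction_eq (of_int k) (of_int ((k * w - 1) * t + ((k - 1) * w - 1)))
          [of_int (w * (t + 1)),
           of_int (w * ((k * w - 1) * t + ((k - 1) * w - 1))),
           of_int ((t + 1) * ((k * w - 1) * t + ((k - 1) * w - 1)))])) \<and>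
   \<comment> \<open>(5), second form\<close>
   (\<forall>w\<in>pos_int. \<forall>k\<in>pos_int. \<forall>S G :: int. \<forall>M\<in>pos_int.
      [S = - 1] (mod w) \<and> [G = - 1] (mod w) \<and>
      S + 1 = k * w \<and> G + 1 = (k - 1) * w \<and> [M = G] (mod S) \<longrightarrow>
      (\<exists>t\<in>pos_int \<union> {0}. M = S * t + G \<and>
        unit_fraction_eq (of_int k) (of_int (S * t + G))
          [of_int (w * (t + 1)), of_int (w * (S * t + G)), of_int ((t + 1) * (S * t + G))])) \<and>
   \<comment> \<open>(6)\<close>
   (\<forall>k\<in>pos_int. \<exists>w\<in>pos_int. k * w > 1 \<and>
      (\<forall>t\<in>pos_int. t > w \<longrightarrow>
        unit_fraction_eq (of_int k) (of_int ((k * w - 1) * (t - w)))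
          [of_int (w * (t - w)),
           of_int (w * t * (k * w - 1)),
           of_int (t * (k * w - 1) * (t - w))])) \<and>
   \<comment> \<open>(7)\<close>
   (\<forall>k\<in>pos_int. \<exists>w\<in>pos_int. k * w > 1 \<and>
      (\<forall>v\<in>pos_int - {1}.
        unit_fraction_eq (of_int k) (of_int ((k * w - 1) * (v - 1)))
          [of_int (w * (v - 1)),
           of_int (v * w * (k * w - 1)),
           of_int (v * w * (k * w - 1) * (v - 1))])) \<and>
   \<comment> \<open>(8)\<close>
   (\<forall>A\<in>pos_nat - {1}. \<forall>A\<^sub>1. A\<^sub>1 = (\<Prod>p\<in>prime_factors A. p) \<longrightarrow>
      (\<forall>b\<in>pos_nat. (A = A\<^sub>1 \<longrightarrow> b \<noteq> 1) \<longrightarrow>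
        (\<exists>c\<in>pos_nat. (A = A\<^sub>1 \<longrightarrow> b > c) \<and> (A \<noteq> A\<^sub>1 \<longrightarrow> b \<ge> c) \<and>
          (\<exists>n\<in>pos_int. int A ^ b - int A\<^sub>1 ^ c > n \<and>
            unit_fraction_eq (of_nat (A ^ b))
              (shifted_factorization A 0 * of_int (int A ^ b - int A\<^sub>1 ^ c - n) * of_int n)
              [shifted_factorization A 0 * of_int n,
               shifted_factorization A (- int c) * of_int (int A ^ b - int A\<^sub>1 ^ c - n) * of_int n,
               shifted_factorization A 0 * of_int (int A ^ b - int A\<^sub>1 ^ c - n)])))) \<and>
   \<comment> \<open>(9)\<close>
   (\<forall>k\<in>pos_int. \<exists>r\<in>pos_int. \<exists>v\<in>pos_int. \<exists>w\<in>pos_int. \<exists>s\<in>pos_int. \<exists>l\<in>pos_int. \<exists>q\<in>pos_int.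
      (k * r * v - l) * s \<ge> r * w \<and> ((k * r * v - l) * s - r * w) dvd r * v * w * l * s \<and>
      (real_of_int k / of_int (w * l) =
          1 / of_int (r * v * w) + 1 / of_int (v * l * s) +
          1 / (of_int (r * v * w * l * s) / of_int ((k * r * v - l) * s - r * w))
        \<longleftrightarrow> 1 / real_of_int s = of_int (k * r * v - l) / of_int (r * w) - of_int (v * l) / of_int q)) \<and>
   \<comment> \<open>(10), upper signs for \<sigma> = 1, lower signs for \<sigma> = - 1\<close>
   (\<forall>\<sigma>\<in>{1, - 1 :: int}. \<forall>k\<in>pos_int. \<forall>m\<in>pos_int.
      \<exists>v\<in>pos_int. \<exists>b\<in>pos_int. k * m * v > - \<sigma> * b \<and>
        (\<exists>s\<in>pos_int. (- \<sigma> * s * b + \<sigma> * v) dvd m * v * s * (k * m * v + \<sigma> * b) \<and>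
          real_of_int k / of_int (k * m * v + \<sigma> * b) =
            1 / of_int (m * v) - of_int \<sigma> * (1 / of_int (m * s * (k * m * v + \<sigma> * b))) +
            1 / (of_int (m * v * s * (k * m * v + \<sigma> * b)) / of_int (- \<sigma> * s * b + \<sigma> * v))))"
proof (intro conjI ballI impI allI, goal_cases)
  case (1 k m)
  show ?case
  proof (intro bexI conjI ballI)
    fix t assume "t \<in> {(k - m) * 2 * r |r. r \<in> pos_int}"
    then obtain r where "t = (k - m) * 2 * r" "r > 0"
      by auto
    then show "unit_fraction_eq (of_int k) (of_int (m * t - (k - m)))
        [1 / of_int (k - m) * of_int (m * t - (k - m)), of_int t,
         of_int t / of_int (k - m) * of_int (m * t - (k - m))]"
      using 1 by (intro unit_fractions_linear[where q = 2 and r = r]) auto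
  qed (use 1 in auto)
next
  case (2 k v)
  show ?case
  proof (intro bexI conjI ballI)
    fix t assume "t \<in> {l * x |l x. l = lcm 1 (v - 1) \<and> k * l * x > v \<and> l \<in> pos_int \<and> x \<in> pos_int}"
    then obtain l x where "t = l * x" "l = lcm 1 (v - 1)" "k * l * x > v" "l > 0" "x > 0"
      by auto
    then have "t > 0" "v - 1 dvd t" "k * t > v"
      by (auto simp: mult.assoc)
    then show "unit_fraction_eq (of_int k) (of_int (k * t - v))
        [of_int t, of_int (t * (k * t - v)) / of_int 1,
         of_int (t * (k * t - v)) / of_int (v - 1)]"
      using 2 by (intro unit_fractions_two_over_product) auto
  qed (use 2 in auto)
next
  case (3 m)
  show ?case
  proof (intro bexI conjI ballI)
    fix t assume t: "t \<in> (if 1 = m then pos_int - {1} else pos_int)"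
    have "m * t > 1"
    proof (cases "m = 1")
      case False
      then have "m * 1 \<le> m * t"
        using t 3 by (intro mult_left_mono) auto
      then show ?thesis
        using False \<open>m \<in> pos_int\<close> unfolding greaterThan_iff by linarith
    qed (use t in auto)
    then show "unit_fraction_eq (of_int m / of_int 1) (of_int (m * t - 1))
        [of_int (t * 1), of_int (t * (m * t - 1))]"
      using 3 t by (intro unit_fractions_two_terms) (auto split: if_splits)
  qed auto
next
  case (4 m)
  show ?case
  proof (cases "m > 2")
    case True
    have *: "unit_fraction_eq (of_int m / of_int 1) (of_int (m * t - (1 + 1)))
        [of_int (1 * t * (m * t - (1 + 1))), of_int (1 * t), of_int (1 * t * (m * t - (1 + 1)))]"
      if "t > 0" for t
    proof -
      have "m * 1 \<le> m * t"
        using that True by (intro mult_left_mono) auto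
      then have "m * t > 2"
        using True by linarith
      then show ?thesis
        using unit_fractions_divisor_pair[of m 1 1 t] True that by auto
    qed
    show ?thesis
      using True * by (intro bexI[of _ 1] conjI impI ballI) auto
  next
    case False
    \<comment> \<open>For \<open>m = 2\<close> the choice \<open>r = 1\<close> fails at \<open>t = 1\<close>, where
      \<open>m * t - (l + d) = 0\<close>. With \<open>r = m\<close> and \<open>l + d = m + 1\<close> neither
      case distinguished in (4) occurs, so no equation is demanded.\<close>
    show ?thesis
      using 4 by (intro bexI[of _ m] bexI[of _ 1] conjI impI) auto
  qed
next
  case (5 k)
  show ?case
  proof (intro bexI[of _ 2] conjI allI impI)
    fix t assume t: "(2 * k - 1) * 2 = 2 \<and> t \<in> pos_int - {1} \<or>
        (2 * k - 1) * 2 > 2 \<and> k \<in> {1, 2} \<and> t \<in> pos_int \<or>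
        (2 * k - 1) * 2 > 2 \<and> k > 2 \<and> t \<in> pos_int \<union> {0}"
    have "(k * 2 - 1) * t + ((k - 1) * 2 - 1) > 0"
    proof (cases "k = 1")
      case False
      then have "(k * 2 - 1) * t \<ge> 0" "(k - 1) * 2 - 1 > 0"
        using t 5 by auto
      then show ?thesis
        by linarith
    qed (use t in auto)
    then show "unit_fraction_eq (of_int k) (of_int ((k * 2 - 1) * t + ((k - 1) * 2 - 1)))
        [of_int (2 * (t + 1)), of_int (2 * ((k * 2 - 1) * t + ((k - 1) * 2 - 1))),
         of_int ((t + 1) * ((k * 2 - 1) * t + ((k - 1) * 2 - 1)))]"
      using 5 t by (intro unit_fractions_residue_class) auto
  next
    show "(2 * k - 1) * 2 \<noteq> 1"
      by presburger
  qed simp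
next
  case (6 w k S G M)
  then have S: "S = k * w - 1" and G: "G = (k - 1) * w - 1" and "M > 0" "w > 0" "k > 0"
    by auto
  have "S \<ge> 0"
    using S \<open>w > 0\<close> \<open>k > 0\<close> by (simp add: int_one_le_iff_zero_less)
  have "[G = M] (mod S)"
    using 6 cong_sym by blast
  then obtain t where t: "M = S * t + G"
    unfolding cong_iff_lin by (metis add.commute)
  \<comment> \<open>A negative \<open>t\<close> would give \<open>M \<le> G - S = - w\<close>.\<close>
  have "t \<ge> 0"
  proof (rule ccontr)
    assume "\<not> t \<ge> 0"
    then have "S * t \<le> S * (- 1)"
      using \<open>S \<ge> 0\<close> by (intro mult_left_mono) auto
    then have "M \<le> - w"
      unfolding t S G by (simp add: algebra_simps)
    then show False
      using \<open>M > 0\<close> \<open>w > 0\<close> by simp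
  qed
  then have "unit_fraction_eq (of_int k) (of_int M)
      [of_int (w * (t + 1)), of_int (w * M), of_int ((t + 1) * M)]"
    using \<open>M > 0\<close> \<open>w > 0\<close> \<open>k > 0\<close> t S G by (intro unit_fractions_residue_class) auto
  then show ?case
    using t \<open>t \<ge> 0\<close> by (intro bexI[of _ t]) auto
next
  case (7 k)
  then show ?case
    by (intro bexI[of _ 2] conjI ballI impI unit_fractions_shift) auto
next
  case (8 k)
  then show ?case
    by (intro bexI[of _ 2] conjI ballI impI unit_fractions_shift_one) auto
next
  case (9 A R b)
  then have "A > 1" and R: "R = (\<Prod>p\<in>prime_factors A. p)" and b: "b > 0" "A = R \<longrightarrow> b \<noteq> 1"
    by simp_all
  then have dvd: "R ^ 1 dvd A" and gt: "int A ^ b - int R ^ 1 > 1"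
    using power_minus_radical_gt_1[OF \<open>A > 1\<close> R b] by (simp_all only: power_one_right)
  have eq: "unit_fraction_eq (of_nat (A ^ b))
      (shifted_factorization A 0 * of_int (int A ^ b - int R ^ 1 - 1) * of_int 1)
      [shifted_factorization A 0 * of_int 1,
       shifted_factorization A (- int 1) * of_int (int A ^ b - int R ^ 1 - 1) * of_int 1,
       shifted_factorization A 0 * of_int (int A ^ b - int R ^ 1 - 1)]"
    using \<open>A > 1\<close> by (intro unit_fractions_radical[OF _ R dvd _ gt]) simp_all
  show ?case
  proof (rule bexI[of _ 1], intro conjI impI)
    show "1 < b" if "A = R"
      using b that by linarith
    show "1 \<le> b"
      using b by linarith
    show "\<exists>n\<in>pos_int. int A ^ b - int R ^ 1 > n \<and>
        unit_fraction_eq (of_nat (A ^ b))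
          (shifted_factorization A 0 * of_int (int A ^ b - int R ^ 1 - n) * of_int n)
          [shifted_factorization A 0 * of_int n,
           shifted_factorization A (- int 1) * of_int (int A ^ b - int R ^ 1 - n) * of_int n,
           shifted_factorization A 0 * of_int (int A ^ b - int R ^ 1 - n)]"
      by (rule bexI[of _ 1]) (use eq gt in \<open>blast, simp\<close>)
  qed simp
next
  case (10 k)
  \<comment> \<open>With \<open>r = w = 1\<close> and \<open>l = k * v - 1\<close> the divisor \<open>(k * r * v - l) * s - r * w\<close>
    is \<open>s - 1\<close>, hence \<open>1\<close> for \<open>s = 2\<close>; \<open>v = 2\<close> makes \<open>l\<close> positive
    even for \<open>k = 1\<close>. Then \<open>q\<close> is the whole product \<open>r * v * w * l * s\<close>.\<close>
  define l where "l = 2 * k - 1"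
  have "l > 0"
    using 10 by (simp add: l_def)
  have D: "(k * 1 * 2 - l) * 2 - 1 * 1 = 1"
    by (simp add: l_def)
  have first: "real_of_int k / of_int (1 * l) =
      1 / of_int (1 * 2 * 1) + 1 / of_int (2 * l * 2) +
      1 / (of_int (1 * 2 * 1 * l * 2) / of_int ((k * 1 * 2 - l) * 2 - 1 * 1))"
    using \<open>l > 0\<close> D by (intro three_fractions_eq) auto
  have second: "1 / real_of_int 2 =
      of_int (k * 1 * 2 - l) / of_int (1 * 1) - of_int (2 * l) / of_int (4 * l)"
    using \<open>l > 0\<close> D by (subst inverse_eq_diff_iff) auto
  show ?case
  proof (rule bexI[of _ 1], rule bexI[of _ 2], rule bexI[of _ 1], rule bexI[of _ 2],
      rule bexI[of _ l], rule bexI[of _ "4 * l"], intro conjI)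
    show "(k * 1 * 2 - l) * 2 - 1 * 1 dvd 1 * 2 * 1 * l * 2"
      unfolding D by simp
    show "1 * 1 \<le> (k * 1 * 2 - l) * 2"
      using D by linarith
  qed (use first second \<open>l > 0\<close> in \<open>simp_all only: greaterThan_iff\<close>, simp_all)
next
  case (11 \<sigma> k m)
  \<comment> \<open>With \<open>v = 2\<close>, \<open>b = 1\<close> and \<open>s = 2 - \<sigma>\<close> the divisor \<open>\<sigma> * (v - s * b)\<close> is
    \<open>\<sigma> * \<sigma> = 1\<close>.\<close>
  have "k * m > 0"
    using 11 by simp
  have z: "- \<sigma> * (2 - \<sigma>) * 1 + \<sigma> * 2 = 1"
    using 11 by auto
  have M: "k * m * 2 > - \<sigma> * 1" "k * m * 2 + \<sigma> * 1 \<noteq> 0"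
  proof -
    have "\<bar>\<sigma>\<bar> = 1"
      using 11 by auto
    then show "k * m * 2 > - \<sigma> * 1" "k * m * 2 + \<sigma> * 1 \<noteq> 0"
      using \<open>k * m > 0\<close> by linarith+
  qed
  have "real_of_int k / of_int (k * m * 2 + \<sigma> * 1) =
      1 / of_int (m * 2) - of_int \<sigma> * (1 / of_int (m * (2 - \<sigma>) * (k * m * 2 + \<sigma> * 1))) +
      1 / (of_int (m * 2 * (2 - \<sigma>) * (k * m * 2 + \<sigma> * 1)) / of_int (- \<sigma> * (2 - \<sigma>) * 1 + \<sigma> * 2))"
    using 11 M z by (intro signed_fractions_eq) auto
  moreover have "- \<sigma> * (2 - \<sigma>) * 1 + \<sigma> * 2 dvd m * 2 * (2 - \<sigma>) * (k * m * 2 + \<sigma> * 1)"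
    unfolding z by simp
  moreover have "2 - \<sigma> \<in> pos_int" "(2::int) \<in> pos_int" "(1::int) \<in> pos_int"
    using 11 by auto
  ultimately show ?case
    using M(1) by blast
qed

end
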